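(* Let $p$ be a prime, let $n, m$ be positive integers, and let $V$ and $W$ be elementary abelian $p$-groups (written additively) of orders $p^n$ and $p^m$ respectively. Let $\alpha : V \times V \rightarrow W$ be a generalized nonsingular map, and let $G = G(\alpha)$ be the group determined by $\alpha$. Then $G$ is a semi-extraspecial group with $|G:G'| = p^{2n}$ and $|G'| = p^m$, and $G$ has abelian subgroups $A$ and $B$ of order $p^{n+m}$ such that $G = AB$ and $A$ and $B$ are elementary abelian $p$-groups. If $p$ is odd, then $G$ has exponent $p$.
   Context: A finite $p$-group $G$ is semi-extraspecial if for every subgroup $N$ of index $p$ in $Z(G)$ the quotient $G/N$ is an extraspecial group. A map $\alpha : V \times V \to W$ is a generalized nonsingular map if it is biadditive and $\alpha(v,V) = \alpha(V,v) = W$ for every $v \in V$ with $v \neq 0$, where $\alpha(v,V)=\{\alpha(v,u) : u\in V\}$ and $\alpha(V,v)=\{\alpha(u,v) : u \in V\}$. For such $\alpha$, the group $G(\alpha)$ is the set $V \times V \times W$ with multiplication $(a_1,b_1,c_1)(a_2,b_2,c_2) = (a_1+a_2,\, b_1+b_2,\, c_1+c_2+\alpha(a_1,b_2))$. *)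

theory Defs
  imports "HOL-Algebra.Multiplicative_Group" "HOL-Algebra.Generated_Groups"
    "HOL-Computational_Algebra.Primes"
begin

definition group_center :: "('a, 'b) monoid_scheme \<Rightarrow> 'a set" where
  "group_center G = {z \<in> carrier G. \<forall>x \<in> carrier G. z \<otimes>\<^bsub>G\<^esub> x = x \<otimes>\<^bsub>G\<^esub> z}"

(* The least common multiple of the element orders. It is 0 when G has no finite exponent,
   since ord is 0 on elements of infinite order and Lcm is 0 on infinite sets. *)
definition group_exponent :: "('a, 'b) monoid_scheme \<Rightarrow> nat" where
  "group_exponent G = Lcm (group.ord G ` carrier G)"

(* order G is 0 for infinite G, so the last conjunct forces G to be finite. *)
definition finite_p_group :: "nat \<Rightarrow> ('a, 'b) monoid_scheme \<Rightarrow> bool" where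
  "finite_p_group p G \<longleftrightarrow> prime p \<and> group G \<and> (\<exists>k::nat. order G = p ^ k)"

definition elementary_abelian :: "nat \<Rightarrow> ('a, 'b) monoid_scheme \<Rightarrow> bool" where
  "elementary_abelian p G \<longleftrightarrow>
     prime p \<and> comm_group G \<and> (\<forall>x \<in> carrier G. x [^]\<^bsub>G\<^esub> p = \<one>\<^bsub>G\<^esub>)"

definition extraspecial :: "nat \<Rightarrow> ('a, 'b) monoid_scheme \<Rightarrow> bool" where
  "extraspecial p G \<longleftrightarrow>
     finite_p_group p G \<and>
     derived G (carrier G) = group_center G \<and>
     card (group_center G) = p \<and>
     elementary_abelian p (G Mod group_center G)"

definition semi_extraspecial :: "nat \<Rightarrow> ('a, 'b) monoid_scheme \<Rightarrow> bool" where
  "semi_extraspecial p G \<longleftrightarrow>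
     finite_p_group p G \<and>
     (\<forall>N. subgroup N (G\<lparr>carrier := group_center G\<rparr>) \<and>
          card (rcosets\<^bsub>G\<lparr>carrier := group_center G\<rparr>\<^esub> N) = p \<longrightarrow>
          extraspecial p (G Mod N))"

(* The additive groups V and W of the mathematics are rendered as HOL-Algebra groups, whose
   operation is written multiplicatively; the zero vector of V is the neutral element of V. *)
definition biadditive ::
  "('a, 'c) monoid_scheme \<Rightarrow> ('b, 'd) monoid_scheme \<Rightarrow> ('a \<Rightarrow> 'a \<Rightarrow> 'b) \<Rightarrow> bool" where
  "biadditive V W \<alpha> \<longleftrightarrow>
     (\<forall>v \<in> carrier V. (\<lambda>u. \<alpha> v u) \<in> hom V W \<and> (\<lambda>u. \<alpha> u v) \<in> hom V W)"

definition generalized_nonsingular_map ::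
  "('a, 'c) monoid_scheme \<Rightarrow> ('b, 'd) monoid_scheme \<Rightarrow> ('a \<Rightarrow> 'a \<Rightarrow> 'b) \<Rightarrow> bool" where
  "generalized_nonsingular_map V W \<alpha> \<longleftrightarrow>
     biadditive V W \<alpha> \<and>
     (\<forall>v \<in> carrier V. v \<noteq> \<one>\<^bsub>V\<^esub> \<longrightarrow>
        (\<lambda>u. \<alpha> v u) ` carrier V = carrier W \<and> (\<lambda>u. \<alpha> u v) ` carrier V = carrier W)"

definition map_group ::
  "('a, 'c) monoid_scheme \<Rightarrow> ('b, 'd) monoid_scheme \<Rightarrow> ('a \<Rightarrow> 'a \<Rightarrow> 'b) \<Rightarrow> ('a \<times> 'a \<times> 'b) monoid" where
  "map_group V W \<alpha> =
     \<lparr>carrier = carrier V \<times> carrier V \<times> carrier W,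
      monoid.mult = (\<lambda>(a1, b1, c1) (a2, b2, c2).
        (a1 \<otimes>\<^bsub>V\<^esub> a2, b1 \<otimes>\<^bsub>V\<^esub> b2, c1 \<otimes>\<^bsub>W\<^esub> c2 \<otimes>\<^bsub>W\<^esub> \<alpha> a1 b2)),
      one = (\<one>\<^bsub>V\<^esub>, \<one>\<^bsub>V\<^esub>, \<one>\<^bsub>W\<^esub>)\<rparr>"

end

theory Submission
  imports Defs
begin

text \<open>For \<open>(a, b) \<noteq> 0\<close> the elements \<open>[(a, b, c), (x, y, z)] = \<alpha>(a, y) - \<alpha>(x, b)\<close> fill \<open>W\<close>, by taking
  \<open>x = 0\<close> or \<open>y = 0\<close> and using nonsingularity. Hence \<open>W\<close> is both the centre and the derived
  subgroup of \<open>G\<close>, and it stays the full centre modulo any proper subgroup of \<open>W\<close>. The \<open>p\<close>-th power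
  of \<open>(a, b, c)\<close> is \<open>(0, 0, (p choose 2) \<alpha>(a, b))\<close>, which is central in general and trivial for
  odd \<open>p\<close>.\<close>

section \<open>Centres, quotients by central subgroups, and the exponent of a general group\<close>

lemma (in group) group_center_subgroup: "subgroup (group_center G) G"
proof (rule subgroupI)
  show "group_center G \<subseteq> carrier G" "group_center G \<noteq> {}"
    by (auto simp: group_center_def)
next
  fix a assume a: "a \<in> group_center G"
  then have ac: "a \<in> carrier G" and comm: "\<And>x. x \<in> carrier G \<Longrightarrow> a \<otimes> x = x \<otimes> a"
    by (auto simp: group_center_def)
  have "inv a \<otimes> x = x \<otimes> inv a" if x: "x \<in> carrier G" for x
  proof -
    have "inv a \<otimes> x = inv (inv x \<otimes> a)" using ac x by (simp add: inv_mult_group)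
    also have "\<dots> = inv (a \<otimes> inv x)" using comm x by simp
    also have "\<dots> = x \<otimes> inv a" using ac x by (simp add: inv_mult_group)
    finally show ?thesis .
  qed
  then show "inv a \<in> group_center G" using ac by (simp add: group_center_def)
next
  fix a b assume "a \<in> group_center G" "b \<in> group_center G"
  then show "a \<otimes> b \<in> group_center G"
    unfolding group_center_def
    by (smt (verit, del_insts) m_assoc m_closed mem_Collect_eq)
qed

text \<open>Conjugation fixes central elements. This makes \<open>G Mod N\<close> a group for the
  subgroups \<open>N\<close> of the centre over which \<open>semi_extraspecial\<close>
  quantifies.\<close>

lemma (in group) central_subgroup_normal:
  assumes "subgroup N G" "N \<subseteq> group_center G"
  shows "N \<lhd> G"
  unfolding normal_inv_iff
proof (intro conjI ballI assms(1))
  fix x h assume x: "x \<in> carrier G" and h: "h \<in> N"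
  then have "h \<in> carrier G" "x \<otimes> h = h \<otimes> x"
    using assms(2) by (auto simp: group_center_def)
  then have "x \<otimes> h \<otimes> inv x = h" using x by (simp add: m_assoc)
  with h show "x \<otimes> h \<otimes> inv x \<in> N" by simp
qed

text \<open>The quotient by the derived subgroup is always abelian, so only the \<open>p\<close>-th
  powers need checking. It is applied to a quotient whose derived subgroup is its centre.\<close>

lemma elementary_abelian_Mod_derived:
  assumes "group H" "prime p"
    and "\<And>x. x \<in> carrier H \<Longrightarrow> x [^]\<^bsub>H\<^esub> p \<in> derived H (carrier H)"
  shows "elementary_abelian p (H Mod derived H (carrier H))"
proof -
  interpret H: group H by fact
  interpret D: normal "derived H (carrier H)" H by (rule H.derived_self_is_normal)
  have "X [^]\<^bsub>H Mod derived H (carrier H)\<^esub> p = derived H (carrier H)"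
    if X: "X \<in> carrier (H Mod derived H (carrier H))" for X
  proof -
    obtain x where x: "x \<in> carrier H" and "X = derived H (carrier H) #>\<^bsub>H\<^esub> x"
      using X by (auto simp: carrier_FactGroup)
    then have "X [^]\<^bsub>H Mod derived H (carrier H)\<^esub> p
        = derived H (carrier H) #>\<^bsub>H\<^esub> (x [^]\<^bsub>H\<^esub> p)"
      by (simp add: D.FactGroup_pow)
    also have "\<dots> = derived H (carrier H)"
      by (rule H.coset_join2) (use assms(3) x D.subgroup_axioms in auto)
    finally show ?thesis .
  qed
  with assms(2) H.derived_quot_is_comm_group show ?thesis
    by (simp add: elementary_abelian_def)
qed

text \<open>The last hypothesis says that \<open>[x, G]\<close> contains the centre for every non-central \<open>x\<close>. If
  \<open>xN\<close> is central in \<open>G / N\<close> then \<open>[x, G] \<subseteq> N\<close>, so for \<open>N\<close> properly contained in the centre no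
  new central elements arise in the quotient.\<close>
lemma (in group) semi_extraspecialI:
  assumes pG: "finite_p_group p G"
    and der: "derived G (carrier G) = group_center G"
    and pow: "\<And>x. x \<in> carrier G \<Longrightarrow> x [^] p \<in> group_center G"
    and comm: "\<And>x z. \<lbrakk>x \<in> carrier G; x \<notin> group_center G; z \<in> group_center G\<rbrakk>
      \<Longrightarrow> \<exists>y \<in> carrier G. x \<otimes> y = z \<otimes> (y \<otimes> x)"
  shows "semi_extraspecial p G"
  unfolding semi_extraspecial_def
proof (intro conjI allI impI pG)
  let ?Z = "group_center G"
  fix N
  assume "subgroup N (G\<lparr>carrier := ?Z\<rparr>) \<and> card (rcosets\<^bsub>G\<lparr>carrier := ?Z\<rparr>\<^esub> N) = p"
  then have NZ: "subgroup N (G\<lparr>carrier := ?Z\<rparr>)"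
    and card: "card (rcosets\<^bsub>G\<lparr>carrier := ?Z\<rparr>\<^esub> N) = p" by auto
  from pG obtain k where p: "prime p" and ordG: "order G = p ^ k"
    by (auto simp: finite_p_group_def)
  have fin: "finite (carrier G)"
    using p ordG by (metis order_gt_0_iff_finite prime_gt_0_nat zero_less_power)
  have Z: "subgroup ?Z G" by (rule group_center_subgroup)
  have N: "subgroup N G" by (rule incl_subgroup[OF Z NZ])
  have sub: "N \<subseteq> ?Z" using subgroup.subset[OF NZ] by simp
  interpret N: normal N G by (rule central_subgroup_normal[OF N sub])
  define Q where "Q = G Mod N"
  interpret Q: group Q unfolding Q_def by (rule N.factorgroup_is_group)
  let ?q = "\<lambda>a. N #> a"
  interpret q: group_hom G Q ?q
    by unfold_locales (simp add: Q_def N.r_coset_hom_Mod)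
  have carrQ: "carrier Q = ?q ` carrier G" by (simp add: Q_def carrier_FactGroup)
  have ZG: "z \<in> carrier G" if "z \<in> ?Z" for z using that by (simp add: group_center_def)
  \<comment> \<open>If \<open>N\<close> were the whole centre, Lagrange inside the centre would give
    \<open>p * card ?Z = card ?Z\<close> with \<open>card ?Z\<close> finite and positive, hence
    \<open>p = 1\<close>.\<close>
  have proper: "\<not> ?Z \<subseteq> N"
  proof
    assume "?Z \<subseteq> N"
    with sub have eq: "N = ?Z" by blast
    interpret Zg: group "G\<lparr>carrier := ?Z\<rparr>" by (rule subgroup_imp_group[OF Z])
    have "p * card ?Z = card ?Z"
      using Zg.lagrange[OF NZ] card eq by (simp add: order_def)
    moreover have "card ?Z > 0"
      using fin Z by (metis card_gt_0_iff finite_subset subgroup.subset subgroup.one_closed empty_iff)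
    ultimately show False using p by simp
  qed
  have center: "group_center Q = ?q ` ?Z"
  proof (intro equalityI subsetI)
    fix X assume "X \<in> group_center Q"
    then have XQ: "X \<in> carrier Q"
      and Xc: "\<And>Y. Y \<in> carrier Q \<Longrightarrow> X \<otimes>\<^bsub>Q\<^esub> Y = Y \<otimes>\<^bsub>Q\<^esub> X"
      by (auto simp: group_center_def)
    from XQ obtain x where x: "x \<in> carrier G" and X: "X = ?q x" by (auto simp: carrQ)
    have "x \<in> ?Z"
    proof (rule ccontr)
      assume nx: "x \<notin> ?Z"
      \<comment> \<open>By \<open>comm\<close>, \<open>z\<close> is a commutator of \<open>x\<close>
        and some \<open>y\<close>. The image of \<open>x\<close> is central in \<open>Q\<close>, so
        \<open>z \<otimes> (y \<otimes> x)\<close> and \<open>y \<otimes> x\<close> lie in one coset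
        of \<open>N\<close>; cancelling \<open>y \<otimes> x\<close> gives
        \<open>z \<in> N\<close>.\<close>
      have "z \<in> N" if z: "z \<in> ?Z" for z
      proof -
        from comm[OF x nx z] obtain y
          where y: "y \<in> carrier G" and xy: "x \<otimes> y = z \<otimes> (y \<otimes> x)" by blast
        have "?q (z \<otimes> (y \<otimes> x)) = ?q (y \<otimes> x)"
          using Xc[of "?q y"] x y xy by (simp add: X carrQ flip: q.hom_mult)
        moreover have "z \<otimes> (y \<otimes> x) \<in> ?q (z \<otimes> (y \<otimes> x))"
          using ZG[OF z] x y N by (intro rcos_self) auto
        ultimately obtain h where "h \<in> N" "z \<otimes> (y \<otimes> x) = h \<otimes> (y \<otimes> x)"
          by (auto simp: r_coset_def)
        with ZG[OF z] x y show "z \<in> N" by (metis N.mem_carrier m_closed right_cancel)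
      qed
      with proper show False by blast
    qed
    with X show "X \<in> ?q ` ?Z" by blast
  next
    fix X assume "X \<in> ?q ` ?Z"
    then obtain z where z: "z \<in> ?Z" and X: "X = ?q z" by blast
    have "?q z \<otimes>\<^bsub>Q\<^esub> ?q x = ?q x \<otimes>\<^bsub>Q\<^esub> ?q z" if "x \<in> carrier G" for x
      using that z ZG[OF z] by (simp add: group_center_def flip: q.hom_mult)
    with ZG[OF z] show "X \<in> group_center Q" by (auto simp: group_center_def X carrQ)
  qed
  \<comment> \<open>Forming the derived subgroup commutes with homomorphic images, and
    \<open>?q\<close> maps onto \<open>Q\<close>.\<close>
  have derQ: "derived Q (carrier Q) = group_center Q"
    using q.derived_img[of "carrier G"] by (simp add: carrQ der center)
  \<comment> \<open>The cosets of \<open>N\<close> by central elements are the same sets whether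
    formed in \<open>G\<close> or in its centre, so the index \<open>p\<close> of \<open>N\<close>
    becomes the order of the centre of \<open>Q\<close>.\<close>
  have "?q ` ?Z = rcosets\<^bsub>G\<lparr>carrier := ?Z\<rparr>\<^esub> N"
    by (auto simp: RCOSETS_def r_coset_def)
  with card center have cardQ: "card (group_center Q) = p" by simp
  have "card (carrier Q) dvd p ^ k"
    using lagrange[OF N] ordG by (metis FactGroup_def Q_def dvd_triv_left partial_object.simps(1))
  then have "\<exists>j. order Q = p ^ j"
    using p by (auto simp: divides_primepow_nat order_def)
  then have pQ: "finite_p_group p Q"
    using p Q.is_group by (simp add: finite_p_group_def)
  have "X [^]\<^bsub>Q\<^esub> p \<in> derived Q (carrier Q)" if "X \<in> carrier Q" for X
    using that pow unfolding derQ center by (auto simp: carrQ simp flip: q.hom_nat_pow)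
  then have "elementary_abelian p (Q Mod group_center Q)"
    using elementary_abelian_Mod_derived[OF Q.is_group p] by (simp add: derQ)
  with pQ derQ cardQ have "extraspecial p Q" by (simp add: extraspecial_def)
  then show "extraspecial p (G Mod N)" by (simp add: Q_def)
qed

text \<open>All element orders divide \<open>p\<close>, and the nontrivial \<open>a\<close> has
  order exactly \<open>p\<close>. Without such an \<open>a\<close> the group would be trivial and
  the \<open>Lcm\<close> equal to 1.\<close>

lemma (in group) group_exponent_prime:
  assumes "prime p" "\<And>x. x \<in> carrier G \<Longrightarrow> x [^] p = \<one>" "a \<in> carrier G" "a \<noteq> \<one>"
  shows "group_exponent G = p"
proof -
  have dvd: "ord x dvd p" if "x \<in> carrier G" for x
    using assms(2)[OF that] that by (simp add: pow_eq_id)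
  have "ord a \<noteq> 1" using assms(3,4) ord_eq_1 by blast
  with dvd[OF assms(3)] assms(1) have "ord a = p" by (auto simp: prime_nat_iff)
  then have "p dvd Lcm (ord ` carrier G)" using assms(3) by (metis dvd_Lcm imageI)
  moreover have "Lcm (ord ` carrier G) dvd p" by (rule Lcm_least) (use dvd in auto)
  ultimately show ?thesis unfolding group_exponent_def by (rule dvd_antisym[rotated])
qed

section \<open>The group of a generalized nonsingular map between abelian groups\<close>

locale nonsingular_map = V: comm_group V + W: comm_group W
  for V :: "('a, 'c) monoid_scheme" (structure)
    and W :: "('b, 'd) monoid_scheme" (structure) +
  fixes \<alpha> :: "'a \<Rightarrow> 'a \<Rightarrow> 'b"
  assumes nonsingular: "generalized_nonsingular_map V W \<alpha>"
begin

abbreviation E where "E \<equiv> map_group V W \<alpha>"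

lemma hom_left: "v \<in> carrier V \<Longrightarrow> (\<lambda>u. \<alpha> u v) \<in> hom V W"
  and hom_right: "v \<in> carrier V \<Longrightarrow> (\<lambda>u. \<alpha> v u) \<in> hom V W"
  using nonsingular by (auto simp: generalized_nonsingular_map_def biadditive_def)

lemma \<alpha>_closed [simp]: "u \<in> carrier V \<Longrightarrow> v \<in> carrier V \<Longrightarrow> \<alpha> u v \<in> carrier W"
  using hom_left[of v] by (auto simp: hom_def)

lemma \<alpha>_mult_left [simp]:
  "\<lbrakk>u \<in> carrier V; u' \<in> carrier V; v \<in> carrier V\<rbrakk> \<Longrightarrow> \<alpha> (u \<otimes>\<^bsub>V\<^esub> u') v = \<alpha> u v \<otimes>\<^bsub>W\<^esub> \<alpha> u' v"
  using hom_left[of v] by (auto simp: hom_def)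

lemma \<alpha>_mult_right [simp]:
  "\<lbrakk>u \<in> carrier V; v \<in> carrier V; v' \<in> carrier V\<rbrakk> \<Longrightarrow> \<alpha> u (v \<otimes>\<^bsub>V\<^esub> v') = \<alpha> u v \<otimes>\<^bsub>W\<^esub> \<alpha> u v'"
  using hom_right[of u] by (auto simp: hom_def)

lemma \<alpha>_one_left [simp]: "v \<in> carrier V \<Longrightarrow> \<alpha> \<one>\<^bsub>V\<^esub> v = \<one>\<^bsub>W\<^esub>"
  using hom_one[OF hom_left] V.is_group W.is_group by blast

lemma \<alpha>_one_right [simp]: "v \<in> carrier V \<Longrightarrow> \<alpha> v \<one>\<^bsub>V\<^esub> = \<one>\<^bsub>W\<^esub>"
  using hom_one[OF hom_right] V.is_group W.is_group by blast

lemma \<alpha>_pow_left: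
  "u \<in> carrier V \<Longrightarrow> v \<in> carrier V \<Longrightarrow> \<alpha> (u [^]\<^bsub>V\<^esub> (k::nat)) v = \<alpha> u v [^]\<^bsub>W\<^esub> k"
  using hom_nat_pow[OF hom_left] V.is_group W.is_group by blast

lemma surj_right:
  assumes "v \<in> carrier V" "v \<noteq> \<one>\<^bsub>V\<^esub>" "w \<in> carrier W"
  obtains u where "u \<in> carrier V" "\<alpha> v u = w"
  using nonsingular assms unfolding generalized_nonsingular_map_def by (metis imageE)

lemma surj_left:
  assumes "v \<in> carrier V" "v \<noteq> \<one>\<^bsub>V\<^esub>" "w \<in> carrier W"
  obtains u where "u \<in> carrier V" "\<alpha> u v = w"
  using nonsingular assms unfolding generalized_nonsingular_map_def by (metis imageE)

lemma carrier_E [simp]: "carrier E = carrier V \<times> carrier V \<times> carrier W"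
  and one_E [simp]: "\<one>\<^bsub>E\<^esub> = (\<one>\<^bsub>V\<^esub>, \<one>\<^bsub>V\<^esub>, \<one>\<^bsub>W\<^esub>)"
  and mult_E [simp]: "(a1, b1, c1) \<otimes>\<^bsub>E\<^esub> (a2, b2, c2) =
    (a1 \<otimes>\<^bsub>V\<^esub> a2, b1 \<otimes>\<^bsub>V\<^esub> b2, c1 \<otimes>\<^bsub>W\<^esub> c2 \<otimes>\<^bsub>W\<^esub> \<alpha> a1 b2)"
  by (simp_all add: map_group_def)

lemma \<alpha>_inv_left:
  "u \<in> carrier V \<Longrightarrow> v \<in> carrier V \<Longrightarrow> \<alpha> (inv\<^bsub>V\<^esub> u) v \<otimes>\<^bsub>W\<^esub> \<alpha> u v = \<one>\<^bsub>W\<^esub>"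
  by (simp flip: \<alpha>_mult_left)

text \<open>The term \<open>\<alpha> a b\<close> in the inverse cancels the cocycle value
  \<open>\<alpha>(-a, b) = -\<alpha>(a, b)\<close> that the product contributes.\<close>

lemma inv_mult_E:
  assumes "a \<in> carrier V" "b \<in> carrier V" "c \<in> carrier W"
  shows "(inv\<^bsub>V\<^esub> a, inv\<^bsub>V\<^esub> b, inv\<^bsub>W\<^esub> c \<otimes>\<^bsub>W\<^esub> \<alpha> a b) \<otimes>\<^bsub>E\<^esub> (a, b, c) = \<one>\<^bsub>E\<^esub>"
proof -
  have "(inv\<^bsub>W\<^esub> c \<otimes>\<^bsub>W\<^esub> \<alpha> a b) \<otimes>\<^bsub>W\<^esub> c = \<alpha> a b"
    using assms by (simp add: W.m_comm[of "inv\<^bsub>W\<^esub> c"] W.m_assoc)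
  then show ?thesis using assms by (simp add: \<alpha>_inv_left W.m_comm[of "\<alpha> a b"])
qed

text \<open>Associativity is the cocycle identity \<open>\<alpha>(a1, b2) + \<alpha>(a1 + a2, b3) =
  \<alpha>(a1, b2 + b3) + \<alpha>(a2, b3)\<close>, which follows from biadditivity. For inverses,
  \<open>groupI\<close> asks only for left ones.\<close>

sublocale E: group E
proof (rule groupI)
  fix x assume "x \<in> carrier E"
  then show "\<exists>y \<in> carrier E. y \<otimes>\<^bsub>E\<^esub> x = \<one>\<^bsub>E\<^esub>"
    using inv_mult_E by (cases x) (force simp del: mult_E one_E)
qed (auto simp: V.m_assoc W.m_ac)

lemma inv_E:
  assumes "a \<in> carrier V" "b \<in> carrier V" "c \<in> carrier W"
  shows "inv\<^bsub>E\<^esub> (a, b, c) = (inv\<^bsub>V\<^esub> a, inv\<^bsub>V\<^esub> b, inv\<^bsub>W\<^esub> c \<otimes>\<^bsub>W\<^esub> \<alpha> a b)"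
  by (rule E.inv_equality[OF inv_mult_E]) (use assms in auto)

text \<open>The cocycle contributes \<open>\<alpha>(a, b)\<close> once for every pair of factors.\<close>
lemma pow_E:
  assumes "a \<in> carrier V" "b \<in> carrier V" "c \<in> carrier W"
  shows "(a, b, c) [^]\<^bsub>E\<^esub> (k::nat) =
    (a [^]\<^bsub>V\<^esub> k, b [^]\<^bsub>V\<^esub> k, c [^]\<^bsub>W\<^esub> k \<otimes>\<^bsub>W\<^esub> \<alpha> a b [^]\<^bsub>W\<^esub> (k choose 2))"
proof (induction k)
  case (Suc k)
  \<comment> \<open>The next factor adds \<open>\<alpha>(k a, b)\<close>, that is \<open>k\<close>
    further copies of \<open>\<alpha>(a, b)\<close>.\<close>
  have "Suc k choose 2 = (k choose 2) + k" by (simp add: numeral_2_eq_2)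
  then have "\<alpha> a b [^]\<^bsub>W\<^esub> (Suc k choose 2) = \<alpha> a b [^]\<^bsub>W\<^esub> (k choose 2) \<otimes>\<^bsub>W\<^esub> \<alpha> a b [^]\<^bsub>W\<^esub> k"
    using assms by (simp add: W.nat_pow_mult)
  with Suc assms show ?case by (simp add: \<alpha>_pow_left W.m_ac)
qed (use assms in \<open>simp add: numeral_2_eq_2\<close>)

text \<open>The equation is \<open>[(a, b, c), y] = (0, 0, w)\<close> with the inverses cleared, the
  form in which \<open>semi_extraspecialI\<close> asks for it. The same fact bounds the centre from
  above and the derived subgroup from below.\<close>

lemma commutator_fills_W:
  assumes "a \<in> carrier V" "b \<in> carrier V" "c \<in> carrier W" "a \<noteq> \<one>\<^bsub>V\<^esub> \<or> b \<noteq> \<one>\<^bsub>V\<^esub>" "w \<in> carrier W"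
  obtains y where "y \<in> carrier E" "(a, b, c) \<otimes>\<^bsub>E\<^esub> y = (\<one>\<^bsub>V\<^esub>, \<one>\<^bsub>V\<^esub>, w) \<otimes>\<^bsub>E\<^esub> (y \<otimes>\<^bsub>E\<^esub> (a, b, c))"
proof (cases "a = \<one>\<^bsub>V\<^esub>")
  case False
  then obtain u where "u \<in> carrier V" "\<alpha> a u = w" using surj_right assms by metis
  with assms show ?thesis
    by (intro that[of "(\<one>\<^bsub>V\<^esub>, u, \<one>\<^bsub>W\<^esub>)"]) (auto simp: V.m_comm W.m_comm)
next
  case True
  \<comment> \<open>For \<open>y = (u, 0, 0)\<close> the cocycle value \<open>\<alpha> u b\<close>
    arises on the side of \<open>y \<otimes> x\<close>, next to \<open>w\<close>, so it has to be
    the inverse of \<open>w\<close>.\<close>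
  with assms obtain u where "u \<in> carrier V" "\<alpha> u b = inv\<^bsub>W\<^esub> w"
    using surj_left by (metis W.inv_closed)
  moreover have "w \<otimes>\<^bsub>W\<^esub> (c \<otimes>\<^bsub>W\<^esub> inv\<^bsub>W\<^esub> w) = c"
    using assms by (metis W.inv_closed W.m_comm W.m_assoc W.r_inv W.r_one)
  ultimately show ?thesis using assms
    by (intro that[of "(u, \<one>\<^bsub>V\<^esub>, \<one>\<^bsub>W\<^esub>)"]) (auto simp: V.m_comm)
qed

text \<open>A central element with a nonzero \<open>V\<close>-coordinate would have only trivial
  commutators, yet \<open>commutator_fills_W\<close> supplies one equal to a nontrivial
  \<open>w\<close>. For trivial \<open>W\<close> the group is abelian, hence the hypothesis.\<close>

lemma center_E:
  assumes "carrier W \<noteq> {\<one>\<^bsub>W\<^esub>}"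
  shows "group_center E = {\<one>\<^bsub>V\<^esub>} \<times> {\<one>\<^bsub>V\<^esub>} \<times> carrier W"
proof (intro equalityI subsetI)
  fix x assume x: "x \<in> group_center E"
  obtain w where w: "w \<in> carrier W" "w \<noteq> \<one>\<^bsub>W\<^esub>" using assms W.one_closed by blast
  obtain a b c where xe: "x = (a, b, c)" by (cases x)
  with x have car: "a \<in> carrier V" "b \<in> carrier V" "c \<in> carrier W" by (auto simp: group_center_def)
  have "a = \<one>\<^bsub>V\<^esub> \<and> b = \<one>\<^bsub>V\<^esub>"
  proof (rule ccontr)
    assume "\<not> ?thesis"
    then obtain y where y: "y \<in> carrier E" "x \<otimes>\<^bsub>E\<^esub> y = (\<one>\<^bsub>V\<^esub>, \<one>\<^bsub>V\<^esub>, w) \<otimes>\<^bsub>E\<^esub> (y \<otimes>\<^bsub>E\<^esub> x)"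
      using commutator_fills_W[OF car _ w(1)] xe by metis
    have xc: "x \<in> carrier E" and "x \<otimes>\<^bsub>E\<^esub> y = y \<otimes>\<^bsub>E\<^esub> x"
      using x y(1) by (auto simp: group_center_def)
    then have "(\<one>\<^bsub>V\<^esub>, \<one>\<^bsub>V\<^esub>, w) \<otimes>\<^bsub>E\<^esub> (y \<otimes>\<^bsub>E\<^esub> x) = \<one>\<^bsub>E\<^esub> \<otimes>\<^bsub>E\<^esub> (y \<otimes>\<^bsub>E\<^esub> x)"
      using y E.l_one[OF E.m_closed[OF y(1) xc]] by metis
    then have "(\<one>\<^bsub>V\<^esub>, \<one>\<^bsub>V\<^esub>, w) = \<one>\<^bsub>E\<^esub>"
      using E.m_closed[OF y(1) xc] w(1) by (subst (asm) E.right_cancel) auto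
    with w(2) show False by simp
  qed
  with car xe show "x \<in> {\<one>\<^bsub>V\<^esub>} \<times> {\<one>\<^bsub>V\<^esub>} \<times> carrier W" by simp
qed (auto simp: group_center_def W.m_comm)

text \<open>Commutators have trivial \<open>V\<close>-coordinates because \<open>V\<close> is
  abelian. Conversely, any nontrivial \<open>a\<close> in \<open>V\<close> makes every element over
  \<open>W\<close> a single commutator with \<open>(a, 0, 0)\<close>.\<close>

lemma derived_E:
  assumes "carrier V \<noteq> {\<one>\<^bsub>V\<^esub>}"
  shows "derived E (carrier E) = {\<one>\<^bsub>V\<^esub>} \<times> {\<one>\<^bsub>V\<^esub>} \<times> carrier W"
proof
  let ?Z = "{\<one>\<^bsub>V\<^esub>} \<times> {\<one>\<^bsub>V\<^esub>} \<times> carrier W"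
  have conj: "x \<otimes>\<^bsub>V\<^esub> y \<otimes>\<^bsub>V\<^esub> inv\<^bsub>V\<^esub> x \<otimes>\<^bsub>V\<^esub> inv\<^bsub>V\<^esub> y = \<one>\<^bsub>V\<^esub>" if "x \<in> carrier V" "y \<in> carrier V" for x y
    using that by (metis V.inv_mult V.m_assoc V.m_closed V.inv_closed V.r_inv)
  have Z: "subgroup ?Z E"
    by (rule E.subgroupI) (auto simp: inv_E)
  have sub: "x \<otimes>\<^bsub>E\<^esub> y \<otimes>\<^bsub>E\<^esub> inv\<^bsub>E\<^esub> x \<otimes>\<^bsub>E\<^esub> inv\<^bsub>E\<^esub> y \<in> ?Z" if "x \<in> carrier E" "y \<in> carrier E" for x y
    using that by (auto simp: inv_E conj)
  show "derived E (carrier E) \<subseteq> ?Z"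
    unfolding derived_def by (rule E.generate_subgroup_incl[OF _ Z]) (use sub in blast)
  show "?Z \<subseteq> derived E (carrier E)"
  proof
    fix z assume z: "z \<in> ?Z"
    then obtain w where w: "w \<in> carrier W" "z = (\<one>\<^bsub>V\<^esub>, \<one>\<^bsub>V\<^esub>, w)" by auto
    obtain a where a: "a \<in> carrier V" "a \<noteq> \<one>\<^bsub>V\<^esub>" using assms V.one_closed by blast
    define x where "x = (a, \<one>\<^bsub>V\<^esub>, \<one>\<^bsub>W\<^esub>)"
    have x: "x \<in> carrier E" using a by (simp add: x_def)
    obtain y where y: "y \<in> carrier E" "x \<otimes>\<^bsub>E\<^esub> y = z \<otimes>\<^bsub>E\<^esub> (y \<otimes>\<^bsub>E\<^esub> x)"
      using commutator_fills_W[of a "\<one>\<^bsub>V\<^esub>" "\<one>\<^bsub>W\<^esub>" w] a w by (auto simp: x_def simp del: mult_E)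
    have zc: "z \<in> carrier E" using w by simp
    have "x \<otimes>\<^bsub>E\<^esub> y \<otimes>\<^bsub>E\<^esub> inv\<^bsub>E\<^esub> x \<otimes>\<^bsub>E\<^esub> inv\<^bsub>E\<^esub> y = z \<otimes>\<^bsub>E\<^esub> (y \<otimes>\<^bsub>E\<^esub> x) \<otimes>\<^bsub>E\<^esub> inv\<^bsub>E\<^esub> (y \<otimes>\<^bsub>E\<^esub> x)"
      using x y zc by (simp only: E.inv_mult_group E.m_assoc E.m_closed E.inv_closed)
    also have "\<dots> = z" using x y zc by (simp only: E.m_assoc E.m_closed E.inv_closed E.r_inv E.r_one)
    finally show "z \<in> derived E (carrier E)"
      unfolding derived_def using x y(1) by (intro generate.incl) (metis (no_types, lifting) UN_iff insertI1)
  qed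
qed

text \<open>Where \<open>\<alpha>\<close> vanishes on \<open>A\<close> and \<open>B\<close>, the
  twist disappears and the restricted multiplication is that of the direct product, so commutativity
  and exponent carry over from \<open>V\<close> and \<open>W\<close>.\<close>

lemma subgroups_E:
  assumes "subgroup A V" "subgroup B V"
    and "\<And>a b. a \<in> A \<Longrightarrow> b \<in> B \<Longrightarrow> \<alpha> a b = \<one>\<^bsub>W\<^esub>"
  shows "subgroup (A \<times> B \<times> carrier W) E"
    and "\<lbrakk>elementary_abelian p V; elementary_abelian p W\<rbrakk>
      \<Longrightarrow> elementary_abelian p (E\<lparr>carrier := A \<times> B \<times> carrier W\<rparr>)"
proof -
  interpret A: subgroup A V by fact
  interpret B: subgroup B V by fact
  show S: "subgroup (A \<times> B \<times> carrier W) E"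
  proof (rule E.subgroupI)
    show "A \<times> B \<times> carrier W \<noteq> {}" using A.one_closed B.one_closed W.one_closed by blast
  qed (auto simp: inv_E)
  assume V: "elementary_abelian p V" and W: "elementary_abelian p W"
  have "comm_group (E\<lparr>carrier := A \<times> B \<times> carrier W\<rparr>)"
    by (rule group.group_comm_groupI[OF E.subgroup_imp_group[OF S]])
      (auto simp: assms(3) V.m_comm W.m_comm)
  moreover have "x [^]\<^bsub>E\<^esub> p = \<one>\<^bsub>E\<^esub>" if "x \<in> A \<times> B \<times> carrier W" for x
    using that V W by (auto simp: pow_E assms(3) elementary_abelian_def)
  ultimately show "elementary_abelian p (E\<lparr>carrier := A \<times> B \<times> carrier W\<rparr>)"
    using V by (simp add: elementary_abelian_def flip: E.nat_pow_consistent)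
qed

end

section \<open>Orders, factorization and exponent for elementary abelian \<open>V\<close> and
  \<open>W\<close>\<close>

theorem theorem1p3:
  fixes p n m :: nat
    and V :: "('a, 'c) monoid_scheme"
    and W :: "('b, 'd) monoid_scheme"
    and \<alpha> :: "'a \<Rightarrow> 'a \<Rightarrow> 'b"
    and G :: "('a \<times> 'a \<times> 'b) monoid"
  assumes "prime p" and "n > 0" and "m > 0"
    and "elementary_abelian p V" and "order V = p ^ n"
    and "elementary_abelian p W" and "order W = p ^ m"
    and "generalized_nonsingular_map V W \<alpha>"
    and "G = map_group V W \<alpha>"
  shows "semi_extraspecial p G
    \<and> card (rcosets\<^bsub>G\<^esub> (derived G (carrier G))) = p ^ (2 * n)
    \<and> card (derived G (carrier G)) = p ^ m
    \<and> (\<exists>A B. subgroup A G \<and> subgroup B G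
         \<and> card A = p ^ (n + m) \<and> card B = p ^ (n + m)
         \<and> A <#>\<^bsub>G\<^esub> B = carrier G
         \<and> elementary_abelian p (G\<lparr>carrier := A\<rparr>)
         \<and> elementary_abelian p (G\<lparr>carrier := B\<rparr>))
    \<and> (odd p \<longrightarrow> group_exponent G = p)"
proof -
  have p1: "1 < p" using \<open>prime p\<close> by (rule prime_gt_1_nat)
  have Vp: "\<And>v. v \<in> carrier V \<Longrightarrow> v [^]\<^bsub>V\<^esub> p = \<one>\<^bsub>V\<^esub>"
    and Wp: "\<And>w. w \<in> carrier W \<Longrightarrow> w [^]\<^bsub>W\<^esub> p = \<one>\<^bsub>W\<^esub>"
    and Vc: "comm_group V" and Wc: "comm_group W"
    using assms by (auto simp: elementary_abelian_def)
  interpret nonsingular_map V W \<alpha>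
    using Vc Wc assms(8) by (intro nonsingular_map.intro nonsingular_map_axioms.intro)
  have G: "G = E" by (rule assms(9))
  have cV: "card (carrier V) = p ^ n" and cW: "card (carrier W) = p ^ m"
    using assms by (auto simp: order_def)
  \<comment> \<open>Positivity of \<open>n\<close> and \<open>m\<close> gives the nontriviality that
    \<open>derived_E\<close> and \<open>center_E\<close> require.\<close>
  have "card (carrier V) \<noteq> 1" "card (carrier W) \<noteq> 1"
    using p1 assms(2,3) by (simp_all add: cV cW)
  then have V1: "carrier V \<noteq> {\<one>\<^bsub>V\<^esub>}" and W1: "carrier W \<noteq> {\<one>\<^bsub>W\<^esub>}" by auto
  have der: "derived G (carrier G) = group_center G"
    unfolding G center_E[OF W1] derived_E[OF V1] ..
  have cG: "order G = p ^ (2 * n + m)"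
    by (simp add: G order_def card_cartesian_product cV cW power_add mult_2)
  have cD: "card (derived G (carrier G)) = p ^ m"
    unfolding G derived_E[OF V1] by (simp add: card_cartesian_product cW)
  have semi: "semi_extraspecial p G"
    unfolding G
  proof (rule E.semi_extraspecialI)
    show "finite_p_group p E"
      using cG assms(1) E.is_group unfolding finite_p_group_def G by blast
    show "derived E (carrier E) = group_center E"
      using der unfolding G .
    show "x [^]\<^bsub>E\<^esub> p \<in> group_center E"
      if "x \<in> carrier E" for x
      using that by (auto simp: pow_E center_E[OF W1] Vp)
    fix x z
    assume xE: "x \<in> carrier E" and xZ: "x \<notin> group_center E" and zZ: "z \<in> group_center E"
    obtain a b c where x: "x = (a, b, c)" by (cases x)
    obtain w where z: "z = (\<one>\<^bsub>V\<^esub>, \<one>\<^bsub>V\<^esub>, w)" and w: "w \<in> carrier W"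
      using zZ unfolding center_E[OF W1] by blast
    have car: "a \<in> carrier V" "b \<in> carrier V" "c \<in> carrier W" using xE x by auto
    have "a \<noteq> \<one>\<^bsub>V\<^esub> \<or> b \<noteq> \<one>\<^bsub>V\<^esub>" using xZ x car by (auto simp: center_E[OF W1])
    then show "\<exists>y \<in> carrier E. x \<otimes>\<^bsub>E\<^esub> y = z \<otimes>\<^bsub>E\<^esub> (y \<otimes>\<^bsub>E\<^esub> x)"
      unfolding x z using commutator_fills_W[OF car _ w] by metis
  qed
  have cR: "card (rcosets\<^bsub>G\<^esub> (derived G (carrier G))) = p ^ (2 * n)"
  proof -
    have "card (rcosets\<^bsub>G\<^esub> (derived G (carrier G))) * p ^ m = p ^ (2 * n) * p ^ m"
      using E.lagrange[OF E.derived_is_subgroup[OF subset_refl]] cD cG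
      unfolding G by (metis power_add)
    then show ?thesis using p1 by simp
  qed
  let ?A = "carrier V \<times> {\<one>\<^bsub>V\<^esub>} \<times> carrier W" and ?B = "{\<one>\<^bsub>V\<^esub>} \<times> carrier V \<times> carrier W"
  \<comment> \<open>One of the two factors is trivial in each case, so \<open>\<alpha>\<close>
    vanishes there by biadditivity.\<close>
  note A = subgroups_E[OF V.subgroup_self V.triv_subgroup]
    and B = subgroups_E[OF V.triv_subgroup V.subgroup_self]
  have "x \<in> ?A <#>\<^bsub>E\<^esub> ?B" if "x \<in> carrier E" for x
  proof -
    obtain a b c where x: "x = (a, b, c)" by (cases x)
    with that have car: "a \<in> carrier V" "b \<in> carrier V" "c \<in> carrier W" by auto
    \<comment> \<open>The product of the two factors contributes \<open>\<alpha> a b\<close>, which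
      is subtracted from \<open>c\<close> in advance.\<close>
    then have "x = (a, \<one>\<^bsub>V\<^esub>, c \<otimes>\<^bsub>W\<^esub> inv\<^bsub>W\<^esub> (\<alpha> a b)) \<otimes>\<^bsub>E\<^esub> (\<one>\<^bsub>V\<^esub>, b, \<one>\<^bsub>W\<^esub>)"
      by (simp add: x W.m_assoc)
    with car show ?thesis unfolding set_mult_def by fastforce
  qed
  then have AB: "?A <#>\<^bsub>G\<^esub> ?B = carrier G"
    unfolding G by (auto simp: set_mult_def)
  have "\<exists>A B. subgroup A G \<and> subgroup B G
         \<and> card A = p ^ (n + m) \<and> card B = p ^ (n + m)
         \<and> A <#>\<^bsub>G\<^esub> B = carrier G
         \<and> elementary_abelian p (G\<lparr>carrier := A\<rparr>)
         \<and> elementary_abelian p (G\<lparr>carrier := B\<rparr>)"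
    using A B AB assms(4,6)
    by (intro exI[of _ ?A] exI[of _ ?B])
      (simp add: G card_cartesian_product cV cW power_add)
  moreover have "group_exponent G = p" if odd: "odd p"
  proof -
    obtain i where "p = 2 * i + 1" using odd by (elim oddE)
    \<comment> \<open>Since \<open>p\<close> divides \<open>p choose 2\<close>, the cocycle term of
      \<open>pow_E\<close> is the \<open>i\<close>-th power of a \<open>p\<close>-th power in
      \<open>W\<close>, hence trivial.\<close>
    then have j: "p choose 2 = p * i" by (simp add: choose_two)
    have "x [^]\<^bsub>G\<^esub> p = \<one>\<^bsub>G\<^esub>" if "x \<in> carrier G" for x
      using that by (auto simp: G pow_E Vp Wp j simp flip: W.nat_pow_pow)
    moreover obtain w where "w \<in> carrier W" "w \<noteq> \<one>\<^bsub>W\<^esub>" using W1 W.one_closed by blast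
    ultimately show ?thesis using \<open>prime p\<close>
      unfolding G by (intro E.group_exponent_prime[where a = "(\<one>\<^bsub>V\<^esub>, \<one>\<^bsub>V\<^esub>, w)"]) auto
  qed
  ultimately show ?thesis using semi cR cD by blast
qed

end
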